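(* Let $N,k\ge1$, let $\bar\rho=(\bar\rho_1,\dots,\bar\rho_k)\in\mathcal{M}^+(\mathbb{R}^N)^k$, let $V=(V_1,\dots,V_k)\in(L^\infty\cap\mathrm{Lip})(\mathbb{R}^N\times\mathbb{R}^k,\mathbb{R}^{N\times k})$ with $V_i:\mathbb{R}^N\times\mathbb{R}^k\to\mathbb{R}^N$, and let $\eta=(\eta_{i,j})\in(L^\infty\cap\mathrm{Lip})(\mathbb{R}^N,\mathbb{R}^{k\times k})$. Then there exists a unique Lagrangian solution of the system $$\partial_t\rho_i+\mathrm{div}\big(\rho_i\,V_i(x,\rho_1*\eta_{i,1},\dots,\rho_k*\eta_{i,k})\big)=0,\qquad (t,x)\in\mathbb{R}_+\times\mathbb{R}^N,\ i\in\{1,\dots,k\},$$ with initial condition $\rho_i(0)=\bar\rho_i$, $i\in\{1,\dots,k\}$.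
   Context: $\mathcal{M}^+(\mathbb{R}^N)$ is the set of positive measures on $\mathbb{R}^N$ with finite total mass. $\mathrm{Lip}$ denotes globally Lipschitz functions. $(\mu*\eta_{i,j})(x)=\int_{\mathbb{R}^N}\eta_{i,j}(x-y)\,d\mu(y)$. For a measurable map $T$ and a measure $\mu$, $T_\sharp\mu$ is the push-forward: $\int\phi\,dT_\sharp\mu=\int\phi\circ T\,d\mu$ for $\phi\in C_c^0$. Lagrangian solution: $\rho\in L^\infty([0,T],\mathcal{M}^+(\mathbb{R}^N)^k)$ is a Lagrangian solution on $[0,T]$ with initial condition $\bar\rho$ if for each $i$ there is an ODE flow $X^i:[0,T]\times\mathbb{R}^N\to\mathbb{R}^N$ solving $$\frac{dX^i}{dt}(t,x)=V_i\big(X^i(t,x),(\rho_{1,t}*\eta_{i,1})(X^i(t,x)),\dots,(\rho_{k,t}*\eta_{i,k})(X^i(t,x))\big),\qquad X^i(0,x)=x,$$ and such that $\rho_{i,t}=(X^i_t)_\sharp\bar\rho_i$ for $t\in[0,T]$, where $X^i_t(x)=X^i(t,x)$. A Lagrangian solution on $\mathbb{R}_+$ is one that is a Lagrangian solution on $[0,T]$ for every $T>0$. *)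

theory Defs
  imports "HOL-Analysis.Analysis"
begin

text \<open>
  The space \<open>\<real>\<^sup>N\<close> is \<^typ>\<open>real^'n\<close>, and the index set \<open>{1,\<dots>,k}\<close> is the finite type \<open>'k\<close>;
  finite types are nonempty, so \<open>N, k \<ge> 1\<close>.
\<close>

definition L_infty_on :: "'a::euclidean_space set \<Rightarrow> ('a \<Rightarrow> 'b::euclidean_space) \<Rightarrow> bool" where
  "L_infty_on S f \<longleftrightarrow>
     f \<in> borel_measurable (lebesgue_on S) \<and> (\<exists>C. AE x in lebesgue_on S. norm (f x) \<le> C)"

definition Lip :: "('a::metric_space \<Rightarrow> 'b::metric_space) \<Rightarrow> bool" where
  "Lip f \<longleftrightarrow> (\<exists>L. L-lipschitz_on UNIV f)"

definition pos_finite_measures :: "(real^'n) measure set" where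
  "pos_finite_measures = {\<mu>. sets \<mu> = sets borel \<and> finite_measure \<mu>}"

definition convolution :: "(real^'n) measure \<Rightarrow> (real^'n \<Rightarrow> real) \<Rightarrow> real^'n \<Rightarrow> real" where
  "convolution \<mu> f x = (\<integral>y. f (x - y) \<partial>\<mu>)"

definition C_c :: "(real^'n \<Rightarrow> real) set" where
  "C_c = {\<phi>. continuous_on UNIV \<phi> \<and> compact (closure {x. \<phi> x \<noteq> 0})}"

text \<open>
  Measurability in time is with respect to the weak-* topology, i.e. tested against \<open>C_c\<close>:
  measurability for the total variation norm would exclude a moving Dirac mass. For a positive
  measure the total variation norm is the total mass.
\<close>

definition L_infty_measures :: "real \<Rightarrow> (real \<Rightarrow> 'k::finite \<Rightarrow> (real^'n) measure) \<Rightarrow> bool" where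
  "L_infty_measures T \<rho> \<longleftrightarrow>
     (\<forall>t\<in>{0..T}. \<forall>i. \<rho> t i \<in> pos_finite_measures) \<and>
     (\<forall>i. \<forall>\<phi>\<in>C_c. (\<lambda>t. \<integral>x. \<phi> x \<partial>\<rho> t i) \<in> borel_measurable (lebesgue_on {0..T})) \<and>
     (\<forall>i. L_infty_on {0..T} (\<lambda>t. measure (\<rho> t i) UNIV))"

text \<open>
  Matrix-valued functions are read row-wise: \<open>V\<^sub>i = V z $ i\<close> and \<open>\<eta>\<^sub>i\<^sub>,\<^sub>j = \<eta> x $ i $ j\<close>.
  The measurability of \<open>X\<^sub>t\<close> is part of the notion of push-forward, since \<^const>\<open>distr\<close> is a
  junk value for non-measurable maps.
\<close>

definition lagrangian_solution_on ::
  "real \<Rightarrow> ((real^'n) \<times> (real^'k) \<Rightarrow> real^'n^'k) \<Rightarrow> (real^'n \<Rightarrow> real^'k^'k) \<Rightarrow>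
   ('k::finite \<Rightarrow> (real^'n) measure) \<Rightarrow> (real \<Rightarrow> 'k \<Rightarrow> (real^'n) measure) \<Rightarrow> bool" where
  "lagrangian_solution_on T V \<eta> \<rho>\<^sub>0 \<rho> \<longleftrightarrow>
     L_infty_measures T \<rho> \<and>
     (\<forall>i. \<exists>X :: real \<Rightarrow> real^'n \<Rightarrow> real^'n.
        (\<forall>x. X 0 x = x) \<and>
        (\<forall>t\<in>{0..T}. \<forall>x.
           ((\<lambda>s. X s x) has_vector_derivative
              V (X t x, \<chi> j. convolution (\<rho> t j) (\<lambda>y. \<eta> y $ i $ j) (X t x)) $ i)
            (at t within {0..T})) \<and>
        (\<forall>t\<in>{0..T}. X t \<in> borel_measurable borel \<and> \<rho> t i = distr (\<rho>\<^sub>0 i) borel (X t)))"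

definition lagrangian_solution ::
  "((real^'n) \<times> (real^'k) \<Rightarrow> real^'n^'k) \<Rightarrow> (real^'n \<Rightarrow> real^'k^'k) \<Rightarrow>
   ('k::finite \<Rightarrow> (real^'n) measure) \<Rightarrow> (real \<Rightarrow> 'k \<Rightarrow> (real^'n) measure) \<Rightarrow> bool" where
  "lagrangian_solution V \<eta> \<rho>\<^sub>0 \<rho> \<longleftrightarrow> (\<forall>T>0. lagrangian_solution_on T V \<eta> \<rho>\<^sub>0 \<rho>)"

end

theory Submission
  imports Defs
begin

text \<open>
  Substituting the push-forward \<open>\<rho>\<^sub>i\<^sub>,\<^sub>t = (X\<^sup>i\<^sub>t)\<^sub>\<sharp> \<rho>\<^sub>0\<^sub>,\<^sub>i\<close> into the convolutions turns the problem into a closed system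
  for the flows alone. For the displacements \<open>X\<^sub>t - id\<close> this is an autonomous ODE in the Banach space
  of bounded continuous functions \<open>\<real>\<^sup>N \<Rightarrow> (\<real>\<^sup>N)\<^sup>k\<close>, whose right-hand side is globally Lipschitz because
  \<open>V\<close> and \<open>\<eta>\<close> are Lipschitz and the total masses are finite. Existence on all of \<open>[0,\<infinity>)\<close> follows from
  the contraction principle in an exponentially weighted norm. The flow of a competing solution is
  only known to be measurable in \<open>x\<close>, so uniqueness is obtained by iterating the same weighted
  estimate pointwise, uniformly in \<open>x\<close> and \<open>i\<close>.
\<close>

section \<open>Exponentially weighted estimates and global ODEs in Banach spaces\<close>

text \<open>Integrating \<open>exp (l * s)\<close> gains a factor \<open>1 / l\<close>, and the
  contribution of the lower endpoint has a favourable sign and is dropped. For large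
  \<open>l\<close> this gain turns a Lipschitz bound into a contraction.\<close>

lemma norm_integral_le_exp:
  fixes f :: "real \<Rightarrow> 'a::banach"
  assumes f: "(f has_integral I) {0..t}" and t: "0 \<le> t" and l: "0 < l"
    and le: "\<And>s. s \<in> {0..t} \<Longrightarrow> norm (f s) \<le> c * exp (l * s)"
  shows "norm I \<le> c / l * exp (l * t)"
proof -
  have "0 \<le> c" using le[of 0] t order_trans[OF norm_ge_zero] by fastforce
  have g: "((\<lambda>s. c * exp (l * s)) has_integral (c / l * exp (l * t) - c / l * exp (l * 0))) {0..t}"
    using l by (intro fundamental_theorem_of_calculus[OF t])
      (auto intro!: derivative_eq_intros simp: has_real_derivative_iff_has_vector_derivative[symmetric])
  have "norm I \<le> c / l * exp (l * t) - c / l * exp (l * 0)"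
    using integral_norm_bound_integral[of f "{0..t}" "\<lambda>s. c * exp (l * s)"] le f g
    by (metis has_integral_integrable_integral)
  moreover have "0 \<le> c / l * exp (l * 0)" using \<open>0 \<le> c\<close> l by simp
  ultimately show ?thesis by linarith
qed

text \<open>Writing \<open>y t = exp (l * t) *\<^sub>R z t\<close> turns the weighted norm of
  \<open>y\<close> into the plain supremum norm of \<open>z\<close>. The fixed point theorem then
  applies on the whole half-line at once, and a single \<open>y\<close> serves every
  \<open>T\<close>.\<close>

lemma lipschitz_ode_global_solution:
  fixes F :: "'a::banach \<Rightarrow> 'a"
  assumes lip: "L-lipschitz_on UNIV F"
  obtains y where "y 0 = y0"
    and "\<And>T t. t \<in> {0..T} \<Longrightarrow> (y has_vector_derivative F (y t)) (at t within {0..T})"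
proof -
  have L: "0 \<le> L" using lip by (rule lipschitz_on_nonneg)
  have FL: "norm (F a - F b) \<le> L * norm (a - b)" for a b
    using lipschitz_on_normD[OF lip] by simp
  have contF: "continuous_on UNIV F" using lip by (rule lipschitz_on_continuous_on)
  \<comment> \<open>This makes the contraction factor \<open>L / l\<close> at most
    \<open>1/2\<close>; the added \<open>1\<close> keeps \<open>l\<close> positive when
    \<open>L = 0\<close>.\<close>
  define l where "l = 2 * (L + 1)"
  have l: "0 < l" using L by (simp add: l_def)
  define g where "g z s = F (exp (l * s) *\<^sub>R apply_bcontfun z s)" for z :: "real \<Rightarrow>\<^sub>C 'a" and s
  define G where "G z u = integral {0..u} (g z)" for z u
  have contg: "continuous_on S (g z)" for S z
    unfolding g_def
    by (intro continuous_on_compose2[OF contF] continuous_intros) auto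
  have intg: "(g z has_integral G z u) {0..u}" for z u
    unfolding G_def by (intro integrable_integral integrable_continuous_interval contg)
  have gdiff: "norm (g z s - g w s) \<le> L * norm (z - w) * exp (l * s)" for z w s
  proof -
    have "norm (g z s - g w s) \<le> L * (exp (l * s) * norm ((z - w) s))"
      unfolding g_def using FL by (metis (no_types, lifting) abs_exp_cancel minus_bcontfun.rep_eq
        norm_scaleR scaleR_diff_right)
    also have "\<dots> \<le> L * (exp (l * s) * norm (z - w))"
      by (intro mult_left_mono L norm_bounded) auto
    finally show ?thesis by (simp add: mult_ac)
  qed
  have gbd: "norm (g z s) \<le> (norm (F 0) + L * norm z) * exp (l * s)" if "0 \<le> s" for z s
  proof -
    have "norm (g z s) \<le> norm (F 0) + norm (g z s - g 0 s)"
      using norm_triangle_ineq[of "F 0" "g z s - F 0"] by (simp add: g_def)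
    also have "\<dots> \<le> norm (F 0) * exp (l * s) + L * norm z * exp (l * s)"
      using gdiff[of z s 0] l that by (intro add_mono) (auto simp: mult_le_cancel_left1)
    finally show ?thesis by (simp add: algebra_simps)
  qed
  have Gder: "(G z has_vector_derivative g z t) (at t within {0..T})" if "t \<in> {0..T}" for z t T
    unfolding G_def by (rule integral_has_vector_derivative[OF contg that])
  have contG: "continuous_on {0..} (G z)" for z
  proof -
    have "continuous (at t within {0..}) (G z)" if "0 \<le> t" for t
    proof -
      have "continuous (at t within {0..t+1}) (G z)"
        using Gder[of t "t+1" z] that by (auto intro: has_vector_derivative_continuous)
      \<comment> \<open>Differentiability is available on bounded intervals only; near
        \<open>t\<close> such an interval with right end \<open>t+1\<close> coincides with the
        half-line.\<close>
      moreover have "at t within {0..t+1} = at t within {0..}"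
        by (rule at_within_nhd[of _ "{t-1<..<t+1}"]) auto
      ultimately show ?thesis by simp
    qed
    then show ?thesis by (auto simp: continuous_on_eq_continuous_within)
  qed
  \<comment> \<open>The Picard operator conjugated by \<open>exp (l * t)\<close>, extended by a constant to negative times
    so that it acts on bounded continuous functions on the whole line.\<close>
  define P where "P z t = exp (- l * max 0 t) *\<^sub>R (y0 + G z (max 0 t))" for z t
  have P_bcont: "P z \<in> bcontfun" for z
  proof (rule bcontfun_normI)
    show "continuous_on UNIV (P z)"
      unfolding P_def by (intro continuous_intros continuous_on_compose2[OF contG]) auto
    fix t :: real
    let ?u = "max 0 t" and ?c = "norm (F 0) + L * norm z"
    have "norm (G z ?u) \<le> ?c / l * exp (l * ?u)"
      by (rule norm_integral_le_exp[OF intg _ l gbd]) auto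
    moreover have "norm y0 \<le> norm y0 * exp (l * ?u)" using l by (simp add: mult_le_cancel_left1)
    ultimately have "norm (y0 + G z ?u) \<le> (norm y0 + ?c / l) * exp (l * ?u)"
      using norm_triangle_ineq[of y0 "G z ?u"] by (simp add: distrib_right)
    then have "exp (- l * ?u) * norm (y0 + G z ?u) \<le> exp (- l * ?u) * ((norm y0 + ?c / l) * exp (l * ?u))"
      by (intro mult_left_mono) auto
    also have "\<dots> = norm y0 + ?c / l" by (simp add: exp_minus field_simps)
    finally show "norm (P z t) \<le> norm y0 + ?c / l" by (simp add: P_def)
  qed
  have PB: "apply_bcontfun (Bcontfun (P z)) = P z" for z
    by (rule Bcontfun_inverse[OF P_bcont])
  have "dist (Bcontfun (P z)) (Bcontfun (P w)) \<le> 1/2 * dist z w" for z w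
  proof (rule dist_bound)
    fix t :: real
    let ?u = "max 0 t"
    have "norm (G z ?u - G w ?u) \<le> L * norm (z - w) / l * exp (l * ?u)"
      by (rule norm_integral_le_exp[OF has_integral_diff[OF intg intg] _ l gdiff]) auto
    then have "exp (- l * ?u) * norm (G z ?u - G w ?u) \<le> exp (- l * ?u) * (L * norm (z - w) / l * exp (l * ?u))"
      by (intro mult_left_mono) auto
    also have "\<dots> = L / l * norm (z - w)" by (simp add: exp_minus field_simps)
    also have "\<dots> \<le> 1/2 * norm (z - w)"
      using L by (intro mult_right_mono) (auto simp: l_def field_simps)
    finally show "dist (Bcontfun (P z) t) (Bcontfun (P w) t) \<le> 1/2 * dist z w"
      by (simp add: PB P_def dist_norm scaleR_diff_right[symmetric])
  qed
  then have "\<exists>!z. Bcontfun (P z) = z"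
    by (intro banach_fix_type[of "1/2"]) auto
  then obtain z where z: "P z = apply_bcontfun z" by (metis PB)
  define y where "y t = y0 + G z t" for t
  \<comment> \<open>At nonnegative times the fixed point equation undoes the weight, so the
    integrand \<open>g z t\<close> is \<open>F (y t)\<close>.\<close>
  have y: "exp (l * t) *\<^sub>R z t = y t" if "0 \<le> t" for t
    using that by (simp add: y_def z[symmetric] P_def exp_minus)
  show ?thesis
  proof
    show "y 0 = y0" by (simp add: y_def G_def)
    fix T t :: real assume t: "t \<in> {0..T}"
    have "(y has_vector_derivative g z t) (at t within {0..T})"
      unfolding y_def using Gder[OF t, of z] by (auto intro!: derivative_eq_intros)
    then show "(y has_vector_derivative F (y t)) (at t within {0..T})"
      using t y[of t] by (simp add: g_def)
  qed
qed

section \<open>From essential bounds to pointwise bounds\<close>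

text \<open>The set where the bound fails is open by continuity and negligible by hypothesis, hence
  empty.\<close>

lemma AE_bounded_continuous_imp_bounded:
  fixes f :: "'a::euclidean_space \<Rightarrow> 'b::real_normed_vector"
  assumes cont: "continuous_on UNIV f" and ae: "AE x in lebesgue. norm (f x) \<le> C"
  shows "norm (f x) \<le> C"
proof (rule ccontr)
  let ?S = "{x. C < norm (f x)}"
  assume "\<not> norm (f x) \<le> C"
  then have "?S \<noteq> {}" by (auto simp: not_le)
  moreover have "open ?S"
    by (intro open_Collect_less continuous_intros cont)
  moreover have "negligible ?S"
    using ae \<open>open ?S\<close> AE_iff_null_sets[of ?S lebesgue]
    by (simp add: negligible_iff_null_sets not_less borel_open)
  ultimately show False using open_not_negligible by blast
qed

lemma L_infty_Lip_bounded:
  assumes "L_infty_on UNIV f" "Lip f"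
  obtains L B where "L-lipschitz_on UNIV f" "\<And>x. norm (f x) \<le> B"
proof -
  obtain L where L: "L-lipschitz_on UNIV f" using assms(2) by (auto simp: Lip_def)
  obtain C where "AE x in lebesgue. norm (f x) \<le> C"
    using assms(1) unfolding L_infty_on_def lebesgue_on_UNIV_eq by blast
  then show thesis
    using that L AE_bounded_continuous_imp_bounded lipschitz_on_continuous_on by blast
qed

section \<open>The closed system for the flows\<close>

text \<open>Allows \<open>lipschitz_ode_global_solution\<close> to be applied with a displacement
  field as the unknown.\<close>

instance bcontfun :: (metric_space, banach) banach ..

locale nonlocal_velocity =
  fixes V :: "(real^'n) \<times> (real^'k) \<Rightarrow> real^'n^'k"
    and \<eta> :: "real^'n \<Rightarrow> real^'k^'k"
    and \<mu> :: "'k::finite \<Rightarrow> (real^'n) measure"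
    and L\<^sub>V L\<^sub>\<eta> B\<^sub>V B\<^sub>\<eta> :: real
  assumes sets_\<mu>: "sets (\<mu> i) = sets borel"
    and finite_\<mu>: "finite_measure (\<mu> i)"
    and lip_V: "L\<^sub>V-lipschitz_on UNIV V"
    and lip_\<eta>: "L\<^sub>\<eta>-lipschitz_on UNIV \<eta>"
    and bounded_V: "norm (V z) \<le> B\<^sub>V"
    and bounded_\<eta>: "norm (\<eta> x) \<le> B\<^sub>\<eta>"
begin

text \<open>These are the convolutions with the push-forwards of \<open>\<mu> j\<close> under
  \<open>Y j\<close>, after the change of variables that leaves only the fixed measures
  \<open>\<mu> j\<close>.\<close>

definition potential :: "'k \<Rightarrow> ('k \<Rightarrow> real^'n \<Rightarrow> real^'n) \<Rightarrow> real^'n \<Rightarrow> real^'k" where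
  "potential i Y z = (\<chi> j. \<integral>y. \<eta> (z - Y j y) $ i $ j \<partial>\<mu> j)"

definition velocity :: "('k \<Rightarrow> real^'n \<Rightarrow> real^'n) \<Rightarrow> 'k \<Rightarrow> real^'n \<Rightarrow> real^'n" where
  "velocity Y i x = V (Y i x, potential i Y (Y i x)) $ i"

definition mass :: real where
  "mass = (\<Sum>j\<in>UNIV. measure (\<mu> j) UNIV)"

text \<open>The Lipschitz constant of \<open>velocity\<close> in the flow, for the supremum norm.
  The factor 2 arises because perturbing the flow moves both the evaluation point and the
  transported mass.\<close>

definition K :: real where
  "K = L\<^sub>V * (1 + 2 * L\<^sub>\<eta> * mass)"

lemma L_nonneg: "0 \<le> L\<^sub>V" "0 \<le> L\<^sub>\<eta>"
  using lip_V lip_\<eta> by (auto intro: lipschitz_on_nonneg)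

lemma mass_nonneg: "0 \<le> mass"
  by (simp add: mass_def sum_nonneg)

lemma K_nonneg: "0 \<le> K"
  using L_nonneg mass_nonneg by (simp add: K_def)

lemma space_\<mu>: "space (\<mu> i) = UNIV"
  using sets_eq_imp_space_eq[OF sets_\<mu>] by simp

lemma \<eta>_component_lipschitz: "\<bar>\<eta> a $ i $ j - \<eta> b $ i $ j\<bar> \<le> L\<^sub>\<eta> * norm (a - b)"
proof -
  have "\<bar>\<eta> a $ i $ j - \<eta> b $ i $ j\<bar> \<le> norm ((\<eta> a - \<eta> b) $ i)"
    using component_le_norm_cart[of "(\<eta> a - \<eta> b) $ i" j] by simp
  also have "\<dots> \<le> norm (\<eta> a - \<eta> b)" by (rule Finite_Cartesian_Product.norm_nth_le)
  also have "\<dots> \<le> L\<^sub>\<eta> * norm (a - b)" using lipschitz_on_normD[OF lip_\<eta>] by simp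
  finally show ?thesis .
qed

lemma \<eta>_component_bounded: "\<bar>\<eta> a $ i $ j\<bar> \<le> B\<^sub>\<eta>"
  using component_le_norm_cart[of "\<eta> a $ i" j] Finite_Cartesian_Product.norm_nth_le[of "\<eta> a" i] bounded_\<eta>[of a]
  by linarith

lemma continuous_\<eta>_component: "continuous_on UNIV (\<lambda>x. \<eta> x $ i $ j)"
  by (intro continuous_intros lipschitz_on_continuous_on[OF lip_\<eta>])

lemma measurable_\<eta>_component: "(\<lambda>x. \<eta> x $ i $ j) \<in> borel_measurable borel"
  using continuous_\<eta>_component by (rule borel_measurable_continuous_onI)

lemma integrable_\<eta>:
  assumes "f \<in> borel_measurable borel"
  shows "integrable (\<mu> j) (\<lambda>y. \<eta> (z - f y) $ i $ j)"
proof -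
  interpret finite_measure "\<mu> j" by (rule finite_\<mu>)
  have "f \<in> borel_measurable (\<mu> j)" using assms by (simp add: measurable_def space_\<mu> sets_\<mu>)
  then have "(\<lambda>y. \<eta> (z - f y) $ i $ j) \<in> borel_measurable (\<mu> j)"
    by (intro measurable_compose[OF _ measurable_\<eta>_component]) measurable
  then show ?thesis
    by (intro integrable_const_bound[of _ B\<^sub>\<eta>]) (auto simp: \<eta>_component_bounded)
qed

text \<open>Only the relative positions \<open>z - Y j y\<close> enter the integrand. Bounding them
  jointly covers both a change of flow and a change of evaluation point under a fixed flow.\<close>

lemma potential_diff:
  assumes Y: "\<And>j. Y j \<in> borel_measurable borel" "\<And>j. Y' j \<in> borel_measurable borel"
    and le: "\<And>j y. norm ((z - Y j y) - (z' - Y' j y)) \<le> e"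
  shows "norm (potential i Y z - potential i Y' z') \<le> L\<^sub>\<eta> * mass * e"
proof -
  have "\<bar>(potential i Y z - potential i Y' z') $ j\<bar> \<le> L\<^sub>\<eta> * e * measure (\<mu> j) UNIV" for j
  proof -
    interpret finite_measure "\<mu> j" by (rule finite_\<mu>)
    have "\<bar>(potential i Y z - potential i Y' z') $ j\<bar>
        = norm (\<integral>y. \<eta> (z - Y j y) $ i $ j - \<eta> (z' - Y' j y) $ i $ j \<partial>\<mu> j)"
      by (simp add: potential_def Bochner_Integration.integral_diff integrable_\<eta> Y)
    also have "\<dots> \<le> (\<integral>y. L\<^sub>\<eta> * e \<partial>\<mu> j)"
    proof (rule Bochner_Integration.integral_norm_bound_integral)
      fix y
      have "L\<^sub>\<eta> * norm ((z - Y j y) - (z' - Y' j y)) \<le> L\<^sub>\<eta> * e"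
        using le L_nonneg by (intro mult_left_mono) auto
      then show "norm (\<eta> (z - Y j y) $ i $ j - \<eta> (z' - Y' j y) $ i $ j) \<le> L\<^sub>\<eta> * e"
        using \<eta>_component_lipschitz[of "z - Y j y" i j "z' - Y' j y"] by simp
    qed (auto intro!: integrable_\<eta> Y)
    finally show ?thesis by (simp add: space_\<mu> mult_ac)
  qed
  then have "norm (potential i Y z - potential i Y' z') \<le> (\<Sum>j\<in>UNIV. L\<^sub>\<eta> * e * measure (\<mu> j) UNIV)"
    by (intro order_trans[OF norm_le_l1_cart] sum_mono)
  then show ?thesis by (simp add: mass_def sum_distrib_left mult_ac)
qed

text \<open>The bound \<open>e\<close> is uniform in \<open>j\<close> and \<open>y\<close> because
  each velocity sees all of the mass. Measurability of the maps suffices, so the estimate also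
  serves for competing solutions.\<close>

lemma velocity_diff:
  assumes Y: "\<And>j. Y j \<in> borel_measurable borel" "\<And>j. Y' j \<in> borel_measurable borel"
    and le: "\<And>j y. norm (Y j y - Y' j y) \<le> e"
  shows "norm (velocity Y i x - velocity Y' i x) \<le> K * e"
proof -
  let ?p = "potential i Y (Y i x)" and ?p' = "potential i Y' (Y' i x)"
  have "norm ((Y i x - Y j y) - (Y' i x - Y' j y)) \<le> 2 * e" for j y
    using norm_triangle_ineq4[of "Y i x - Y' i x" "Y j y - Y' j y"] le[of i x] le[of j y]
    by (simp add: algebra_simps)
  then have p: "norm (?p - ?p') \<le> L\<^sub>\<eta> * mass * (2 * e)"
    by (intro potential_diff Y)
  have "norm (velocity Y i x - velocity Y' i x) \<le> norm (V (Y i x, ?p) - V (Y' i x, ?p'))"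
    using Finite_Cartesian_Product.norm_nth_le[of "V (Y i x, ?p) - V (Y' i x, ?p')" i] by (simp add: velocity_def)
  also have "\<dots> \<le> L\<^sub>V * norm ((Y i x, ?p) - (Y' i x, ?p'))"
    using lipschitz_on_normD[OF lip_V] by blast
  also have "\<dots> \<le> L\<^sub>V * (norm (Y i x - Y' i x) + norm (?p - ?p'))"
    using norm_Pair_le[of "Y i x - Y' i x" "?p - ?p'"] L_nonneg by (intro mult_left_mono) auto
  also have "\<dots> \<le> L\<^sub>V * (e + L\<^sub>\<eta> * mass * (2 * e))"
    using le p L_nonneg by (intro mult_left_mono add_mono) auto
  finally show ?thesis by (simp add: K_def algebra_simps)
qed

lemma velocity_bounded: "norm (velocity Y i x) \<le> B\<^sub>V"
  unfolding velocity_def using Finite_Cartesian_Product.norm_nth_le bounded_V order_trans by blast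

text \<open>Keeps the right-hand side of the ODE inside the space of continuous functions; the
  potential is even Lipschitz in the evaluation point.\<close>

lemma continuous_velocity:
  assumes Y: "\<And>j. continuous_on UNIV (Y j)"
  shows "continuous_on UNIV (velocity Y i)"
proof -
  have m: "Y j \<in> borel_measurable borel" for j
    using Y by (rule borel_measurable_continuous_onI)
  have "(L\<^sub>\<eta> * mass)-lipschitz_on UNIV (potential i Y)"
    using L_nonneg mass_nonneg
    by (intro lipschitz_onI) (auto simp: dist_norm intro!: potential_diff m)
  then have p: "continuous_on UNIV (potential i Y)" by (rule lipschitz_on_continuous_on)
  show ?thesis
    unfolding velocity_def
    by (intro continuous_intros continuous_on_compose2[OF lipschitz_on_continuous_on[OF lip_V]]
        continuous_on_compose2[OF p] Y) auto
qed

section \<open>Existence and uniqueness of the flow\<close>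

lemma flow_exists:
  obtains X :: "real \<Rightarrow> 'k \<Rightarrow> real^'n \<Rightarrow> real^'n" where
    "\<And>i x. X 0 i x = x" and "\<And>t i. continuous_on UNIV (X t i)"
    and "\<And>T t i x. t \<in> {0..T} \<Longrightarrow>
      ((\<lambda>s. X s i x) has_vector_derivative velocity (X t) i x) (at t within {0..T})"
proof -
  define Y where "Y D i x = x + apply_bcontfun D x $ i" for D :: "(real^'n) \<Rightarrow>\<^sub>C (real^'n^'k)" and i x
  define F where "F D x = (\<chi> i. velocity (Y D) i x)" for D x
  have contY: "continuous_on UNIV (Y D i)" for D i
    unfolding Y_def by (intro continuous_intros continuous_on_apply_bcontfun)
  have measY: "Y D i \<in> borel_measurable borel" for D i
    using contY by (rule borel_measurable_continuous_onI)
  \<comment> \<open>Comparison with the sum of the norms loses a factor \<open>CARD('k)\<close>,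
    which is harmless since any finite Lipschitz constant will do.\<close>
  have norm_vec_le: "norm v \<le> real CARD('k) * b" if "\<And>i. norm (v $ i) \<le> b" for v :: "real^'n^'k" and b
  proof -
    have "norm v \<le> (\<Sum>i\<in>UNIV. norm (v $ i))"
      unfolding norm_vec_def by (rule L2_set_le_sum) auto
    also have "\<dots> \<le> (\<Sum>i\<in>(UNIV::'k set). b)" by (intro sum_mono that)
    finally show ?thesis by simp
  qed
  have "F D \<in> bcontfun" for D
  proof (rule bcontfun_normI)
    show "continuous_on UNIV (F D)"
      unfolding F_def by (intro continuous_intros continuous_velocity contY)
    show "norm (F D x) \<le> real CARD('k) * B\<^sub>V" for x
      by (rule norm_vec_le) (simp add: F_def velocity_bounded)
  qed
  then have F: "apply_bcontfun (Bcontfun (F D)) = F D" for D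
    by (rule Bcontfun_inverse)
  have "(real CARD('k) * K)-lipschitz_on UNIV (\<lambda>D. Bcontfun (F D))"
  proof (rule lipschitz_onI)
    fix D D'
    have "norm (Y D j y - Y D' j y) \<le> dist D D'" for j y
      using Finite_Cartesian_Product.norm_nth_le[of "D y - D' y" j] dist_bounded[of D y D'] by (simp add: Y_def dist_norm)
    then have "norm (velocity (Y D) i x - velocity (Y D') i x) \<le> K * dist D D'" for i x
      by (intro velocity_diff measY)
    then have "norm (F D x - F D' x) \<le> real CARD('k) * (K * dist D D')" for x
      by (intro norm_vec_le) (simp add: F_def)
    then show "dist (Bcontfun (F D)) (Bcontfun (F D')) \<le> real CARD('k) * K * dist D D'"
      by (intro dist_bound) (simp add: F dist_norm mult.assoc)
  qed (simp add: K_nonneg)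
  then obtain D where D0: "D 0 = 0" and D: "\<And>T t. t \<in> {0..T} \<Longrightarrow>
      (D has_vector_derivative Bcontfun (F (D t))) (at t within {0..T})"
    by (rule lipschitz_ode_global_solution) (rule that)
  show ?thesis
  proof
    show "Y (D 0) i x = x" for i x by (simp add: D0 Y_def)
    show "continuous_on UNIV (Y (D t) i)" for t i by (rule contY)
    fix T t :: real and i x assume t: "t \<in> {0..T}"
    \<comment> \<open>Evaluation at a point is bounded and linear, so the derivative in the supremum
      norm passes to each trajectory.\<close>
    have "bounded_linear (\<lambda>D :: (real^'n) \<Rightarrow>\<^sub>C (real^'n^'k). apply_bcontfun D x)"
      by (rule bounded_linear_intro[of _ 1]) (auto simp: norm_bounded)
    then have "bounded_linear (\<lambda>D :: (real^'n) \<Rightarrow>\<^sub>C (real^'n^'k). apply_bcontfun D x $ i)"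
      by (rule bounded_linear_compose[OF bounded_linear_vec_nth])
    from bounded_linear.has_vector_derivative[OF this D[OF t]]
    have "((\<lambda>s. D s x $ i) has_vector_derivative velocity (Y (D t)) i x) (at t within {0..T})"
      by (simp add: F F_def)
    then show "((\<lambda>s. Y (D s) i x) has_vector_derivative velocity (Y (D t)) i x) (at t within {0..T})"
      unfolding Y_def[of "D _"] by (auto intro!: derivative_eq_intros)
  qed
qed

text \<open>A Gronwall argument by iteration: each pass through the integral equation halves a
  pointwise bound, so a supremum over \<open>x\<close> never has to be integrated in time.\<close>

lemma flow_unique:
  fixes X X' :: "real \<Rightarrow> 'k \<Rightarrow> real^'n \<Rightarrow> real^'n"
  assumes init: "\<And>i x. X 0 i x = x" "\<And>i x. X' 0 i x = x"
    and meas: "\<And>t i. t \<in> {0..T} \<Longrightarrow> X t i \<in> borel_measurable borel"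
      "\<And>t i. t \<in> {0..T} \<Longrightarrow> X' t i \<in> borel_measurable borel"
    and deriv: "\<And>t i x. t \<in> {0..T} \<Longrightarrow>
        ((\<lambda>s. X s i x) has_vector_derivative velocity (X t) i x) (at t within {0..T})"
      "\<And>t i x. t \<in> {0..T} \<Longrightarrow>
        ((\<lambda>s. X' s i x) has_vector_derivative velocity (X' t) i x) (at t within {0..T})"
    and t: "t \<in> {0..T}"
  shows "X t = X' t"
proof -
  define l where "l = 2 * (K + 1)"
  have l: "0 < l" using K_nonneg by (simp add: l_def)
  \<comment> \<open>Two velocities differ by at most \<open>2 * B\<^sub>V\<close>, and one weighted
    integration divides this by \<open>l\<close>.\<close>
  define M where "M = 2 * B\<^sub>V / l"
  have BV: "0 \<le> B\<^sub>V" using norm_ge_zero bounded_V order_trans by blast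
  \<comment> \<open>The gauge integral of a derivative always exists, so no regularity of the
    velocities in time is required.\<close>
  have integral: "((\<lambda>s. velocity (X s) i x - velocity (X' s) i x)
      has_integral (X t i x - X' t i x)) {0..t}" if "t \<in> {0..T}" for t i x
  proof -
    have "((\<lambda>s. velocity (X s) i x - velocity (X' s) i x)
        has_integral ((X t i x - X' t i x) - (X 0 i x - X' 0 i x))) {0..t}"
      using that
      by (intro fundamental_theorem_of_calculus has_vector_derivative_diff
          has_vector_derivative_within_subset[OF deriv(1)] has_vector_derivative_within_subset[OF deriv(2)]) auto
    then show ?thesis by (simp add: init)
  qed
  have bound: "norm (X t i x - X' t i x) \<le> M / 2 ^ n * exp (l * t)" if "t \<in> {0..T}" for n t i x
    using that
  \<comment> \<open>The nonlocal estimate uses the previous bound at all earlier times, for all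
    indices and all points.\<close>
  proof (induction n arbitrary: t i x)
    case 0
    have "norm (velocity (X s) i x - velocity (X' s) i x) \<le> 2 * B\<^sub>V * exp (l * s)" if "s \<in> {0..t}" for s
    proof -
      have "norm (velocity (X s) i x - velocity (X' s) i x) \<le> 2 * B\<^sub>V"
        using norm_triangle_ineq4[of "velocity (X s) i x" "velocity (X' s) i x"]
          velocity_bounded[of "X s" i x] velocity_bounded[of "X' s" i x] by simp
      also have "\<dots> \<le> 2 * B\<^sub>V * exp (l * s)" using BV l that by (simp add: mult_le_cancel_left1)
      finally show ?thesis .
    qed
    then have "norm (X t i x - X' t i x) \<le> 2 * B\<^sub>V / l * exp (l * t)"
      using 0 by (intro norm_integral_le_exp[OF integral _ l]) auto
    then show ?case by (simp add: M_def)
  next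
    case (Suc n)
    have "norm (velocity (X s) i x - velocity (X' s) i x) \<le> K * (M / 2 ^ n) * exp (l * s)"
      if "s \<in> {0..t}" for s
      unfolding mult.assoc[of K] using that Suc by (intro velocity_diff meas) auto
    then have "norm (X t i x - X' t i x) \<le> K * (M / 2 ^ n) / l * exp (l * t)"
      using Suc.prems by (intro norm_integral_le_exp[OF integral _ l]) auto
    also have "\<dots> = K / l * (M / 2 ^ n) * exp (l * t)" by simp
    also have "\<dots> \<le> 1 / 2 * (M / 2 ^ n) * exp (l * t)"
      using K_nonneg BV l by (intro mult_right_mono) (auto simp: l_def M_def field_simps)
    finally show ?case by simp
  qed
  have "(\<lambda>n. M / 2 ^ n * exp (l * t)) \<longlonglongrightarrow> 0"
    by (intro tendsto_mult_left_zero LIMSEQ_divide_realpow_zero) auto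
  then have "norm (X t i x - X' t i x) \<le> 0" for i x
    using bound[OF t] by (intro LIMSEQ_le_const) auto
  then show ?thesis by (intro ext) simp
qed

end

section \<open>Weak-* continuity in time\<close>

text \<open>Dominated convergence along sequences, with the constant \<open>C\<close> as integrable
  majorant because \<open>M\<close> is finite. It yields the measurability in time of the
  push-forwards.\<close>

lemma continuous_on_integral_bounded:
  fixes \<phi> :: "'a::topological_space \<Rightarrow> real" and X :: "'b::{first_countable_topology, t2_space} \<Rightarrow> 'c \<Rightarrow> 'a"
  assumes "finite_measure M"
    and \<phi>: "continuous_on UNIV \<phi>" "\<And>x. \<bar>\<phi> x\<bar> \<le> C"
    and meas: "\<And>t. t \<in> S \<Longrightarrow> X t \<in> borel_measurable M"
    and cont: "\<And>x. continuous_on S (\<lambda>t. X t x)"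
  shows "continuous_on S (\<lambda>t. \<integral>x. \<phi> (X t x) \<partial>M)"
  unfolding continuous_on_sequentially comp_def
proof (intro allI ballI impI, elim conjE)
  interpret finite_measure M by fact
  have m: "(\<lambda>x. \<phi> (X t x)) \<in> borel_measurable M" if "t \<in> S" for t
    using meas[OF that] borel_measurable_continuous_onI[OF \<phi>(1)] by (rule measurable_compose)
  fix u t assume u: "\<forall>n. u n \<in> S" "t \<in> S" "u \<longlonglongrightarrow> t"
  show "(\<lambda>n. \<integral>x. \<phi> (X (u n) x) \<partial>M) \<longlonglongrightarrow> (\<integral>x. \<phi> (X t x) \<partial>M)"
  proof (rule integral_dominated_convergence[where w = "\<lambda>_. C"])
    have "(\<lambda>n. \<phi> (X (u n) x)) \<longlonglongrightarrow> \<phi> (X t x)" for x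
      using u continuous_on_compose2[OF \<phi>(1) cont[of x]]
      by (auto simp: continuous_on_sequentially comp_def)
    then show "AE x in M. (\<lambda>n. \<phi> (X (u n) x)) \<longlonglongrightarrow> \<phi> (X t x)" by simp
  qed (use u m \<phi> in auto)
qed

lemma C_c_bounded:
  assumes "\<phi> \<in> C_c"
  obtains C where "\<And>x. \<bar>\<phi> x\<bar> \<le> C"
proof -
  let ?S = "closure {x. \<phi> x \<noteq> 0}"
  have "bounded (\<phi> ` ?S)"
    using assms by (intro compact_imp_bounded compact_continuous_image)
      (auto simp: C_c_def intro: continuous_on_subset)
  then obtain C where C: "\<And>x. x \<in> ?S \<Longrightarrow> \<bar>\<phi> x\<bar> \<le> C"
    by (auto simp: bounded_iff)
  \<comment> \<open>If the support is empty, \<open>C\<close> is unconstrained and may be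
    negative.\<close>
  have "\<bar>\<phi> x\<bar> \<le> max C 0" for x
    using C[of x] closure_subset[of "{x. \<phi> x \<noteq> 0}"] by (cases "\<phi> x = 0") auto
  then show thesis by (rule that)
qed

section \<open>From flows to Lagrangian solutions and back\<close>

theorem theorem4p4:
  fixes V :: "(real^'n) \<times> (real^'k) \<Rightarrow> real^'n^'k"
    and \<eta> :: "real^'n \<Rightarrow> real^'k^'k"
    and \<rho>\<^sub>0 :: "'k::finite \<Rightarrow> (real^'n) measure"
  assumes "\<forall>i. \<rho>\<^sub>0 i \<in> pos_finite_measures"
    and "L_infty_on UNIV V" and "Lip V"
    and "L_infty_on UNIV \<eta>" and "Lip \<eta>"
  shows "\<exists>\<rho>. lagrangian_solution V \<eta> \<rho>\<^sub>0 \<rho> \<and>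
           (\<forall>\<rho>'. lagrangian_solution V \<eta> \<rho>\<^sub>0 \<rho>' \<longrightarrow> (\<forall>t\<ge>0. \<forall>i. \<rho>' t i = \<rho> t i))"
proof -
  obtain L\<^sub>V B\<^sub>V where V: "L\<^sub>V-lipschitz_on UNIV V" "\<And>z. norm (V z) \<le> B\<^sub>V"
    by (rule L_infty_Lip_bounded[OF assms(2,3)]) (rule that)
  obtain L\<^sub>\<eta> B\<^sub>\<eta> where \<eta>: "L\<^sub>\<eta>-lipschitz_on UNIV \<eta>" "\<And>z. norm (\<eta> z) \<le> B\<^sub>\<eta>"
    by (rule L_infty_Lip_bounded[OF assms(4,5)]) (rule that)
  interpret nonlocal_velocity V \<eta> \<rho>\<^sub>0 L\<^sub>V L\<^sub>\<eta> B\<^sub>V B\<^sub>\<eta>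
    using assms(1) V \<eta> by (intro nonlocal_velocity.intro) (auto simp: pos_finite_measures_def)
  have measurable_\<rho>\<^sub>0: "f \<in> borel_measurable borel \<Longrightarrow> f \<in> borel_measurable (\<rho>\<^sub>0 i)"
    for f :: "real^'n \<Rightarrow> real^'n" and i
    by (simp add: measurable_def space_\<mu> sets_\<mu>)
  \<comment> \<open>The change of variables linking the two formulations; it is used for the
    constructed solution and again for a competing one.\<close>
  have velocity_distr: "V (Y i x, \<chi> j. convolution (r j) (\<lambda>y. \<eta> y $ i $ j) (Y i x)) $ i = velocity Y i x"
    if "\<And>j. Y j \<in> borel_measurable borel" and "\<And>j. r j = distr (\<rho>\<^sub>0 j) borel (Y j)" for Y r i x
  proof -
    have "convolution (r j) (\<lambda>y. \<eta> y $ i $ j) z = (\<integral>y. \<eta> (z - Y j y) $ i $ j \<partial>\<rho>\<^sub>0 j)" for j z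
      unfolding convolution_def that(2)
      by (intro integral_distr measurable_\<rho>\<^sub>0 that(1) measurable_compose[OF _ measurable_\<eta>_component])
        measurable
    then show ?thesis by (simp add: velocity_def potential_def)
  qed
  obtain X :: "real \<Rightarrow> 'k \<Rightarrow> real^'n \<Rightarrow> real^'n" where X0: "\<And>i x. X 0 i x = x"
    and contX: "\<And>t i. continuous_on UNIV (X t i)"
    and derX: "\<And>T t i x. t \<in> {0..T} \<Longrightarrow>
      ((\<lambda>s. X s i x) has_vector_derivative velocity (X t) i x) (at t within {0..T})"
    by (rule flow_exists) (rule that)
  have measX: "X t i \<in> borel_measurable borel" for t i
    using contX by (rule borel_measurable_continuous_onI)
  define \<rho> where "\<rho> t i = distr (\<rho>\<^sub>0 i) borel (X t i)" for t i
  \<comment> \<open>Push-forward preserves mass, so the total mass is constant in time and trivially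
    essentially bounded.\<close>
  have total: "measure (\<rho> t i) UNIV = measure (\<rho>\<^sub>0 i) UNIV" for t i
    unfolding \<rho>_def by (subst measure_distr) (auto simp: measurable_\<rho>\<^sub>0 measX space_\<mu>)
  have "L_infty_measures T \<rho>" for T
    unfolding L_infty_measures_def
  proof (intro conjI ballI allI)
    show "\<rho> t i \<in> pos_finite_measures" for t i
      unfolding pos_finite_measures_def \<rho>_def
      using finite_measure.finite_measure_distr[OF finite_\<mu> measurable_\<rho>\<^sub>0[OF measX]] by auto
    show "L_infty_on {0..T} (\<lambda>t. measure (\<rho> t i) UNIV)" for i
      unfolding L_infty_on_def total by auto
    fix i and \<phi> :: "real^'n \<Rightarrow> real" assume "\<phi> \<in> C_c"
    obtain C where C: "\<And>x. \<bar>\<phi> x\<bar> \<le> C" by (rule C_c_bounded[OF \<open>\<phi> \<in> C_c\<close>]) (rule that)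
    have \<phi>: "continuous_on UNIV \<phi>" using \<open>\<phi> \<in> C_c\<close> by (simp add: C_c_def)
    have "continuous_on {0..T} (\<lambda>t. X t i x)" for x
      by (rule continuous_on_vector_derivative[OF derX])
    then have "continuous_on {0..T} (\<lambda>t. \<integral>x. \<phi> (X t i x) \<partial>\<rho>\<^sub>0 i)"
      by (intro continuous_on_integral_bounded[OF finite_\<mu> \<phi> C]) (auto intro: measurable_\<rho>\<^sub>0 measX)
    also have "(\<lambda>t. \<integral>x. \<phi> (X t i x) \<partial>\<rho>\<^sub>0 i) = (\<lambda>t. \<integral>x. \<phi> x \<partial>\<rho> t i)"
      unfolding \<rho>_def
      by (intro ext integral_distr[symmetric] measurable_\<rho>\<^sub>0 measX borel_measurable_continuous_onI \<phi>)
    finally show "(\<lambda>t. \<integral>x. \<phi> x \<partial>\<rho> t i) \<in> borel_measurable (lebesgue_on {0..T})"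
      by (rule continuous_imp_measurable_on_sets_lebesgue) auto
  qed
  moreover have "V (X t i x, \<chi> j. convolution (\<rho> t j) (\<lambda>y. \<eta> y $ i $ j) (X t i x)) $ i
      = velocity (X t) i x" for t i x
    by (rule velocity_distr) (auto simp: measX \<rho>_def)
  ultimately have "lagrangian_solution V \<eta> \<rho>\<^sub>0 \<rho>"
    unfolding lagrangian_solution_def lagrangian_solution_on_def
    using X0 derX measX \<rho>_def by (intro allI impI conjI exI[of _ "\<lambda>t. X t _"]) auto
  moreover have "\<rho>' t i = \<rho> t i" if sol: "lagrangian_solution V \<eta> \<rho>\<^sub>0 \<rho>'" and "0 \<le> t" for \<rho>' t i
  proof -
    \<comment> \<open>Solutions are only given on intervals with \<open>T > 0\<close>, and
      \<open>t = 0\<close> must be covered as well.\<close>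
    define T where "T = t + 1"
    have t: "t \<in> {0..T}" "0 < T" using \<open>0 \<le> t\<close> by (auto simp: T_def)
    \<comment> \<open>Naming the property allows one flow to be chosen for every index
      simultaneously.\<close>
    define flow where "flow i X' \<longleftrightarrow> (\<forall>x. X' 0 x = x) \<and>
        (\<forall>t\<in>{0..T}. \<forall>x. ((\<lambda>s. X' s x) has_vector_derivative
          V (X' t x, \<chi> j. convolution (\<rho>' t j) (\<lambda>y. \<eta> y $ i $ j) (X' t x)) $ i) (at t within {0..T})) \<and>
        (\<forall>t\<in>{0..T}. X' t \<in> borel_measurable borel \<and> \<rho>' t i = distr (\<rho>\<^sub>0 i) borel (X' t))" for i X'
    have "\<forall>i. \<exists>X'. flow i X'"
      using sol t(2) unfolding lagrangian_solution_def lagrangian_solution_on_def flow_def by blast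
    then obtain X' where flow: "\<And>i. flow i (X' i)" by metis
    have X'0: "X' i 0 x = x" for i x
      using flow[of i] by (simp add: flow_def)
    have derX': "((\<lambda>s. X' i s x) has_vector_derivative
          V (X' i t x, \<chi> j. convolution (\<rho>' t j) (\<lambda>y. \<eta> y $ i $ j) (X' i t x)) $ i) (at t within {0..T})"
      if "t \<in> {0..T}" for i t x
      using flow[of i] that by (simp add: flow_def)
    have measX': "X' i t \<in> borel_measurable borel"
      and \<rho>': "\<rho>' t i = distr (\<rho>\<^sub>0 i) borel (X' i t)" if "t \<in> {0..T}" for i t
      using flow[of i] that by (simp_all add: flow_def)
    \<comment> \<open>Since \<open>\<rho>'\<close> is the push-forward under the chosen flows, these
      solve the same closed system as \<open>X\<close>; equal flows give equal measures.\<close>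
    have "X t = (\<lambda>i. X' i t)"
    proof (rule flow_unique[where T = T and X' = "\<lambda>t i. X' i t"])
      fix s i x assume s: "s \<in> {0..T}"
      have "V (X' i s x, \<chi> j. convolution (\<rho>' s j) (\<lambda>y. \<eta> y $ i $ j) (X' i s x)) $ i
          = velocity (\<lambda>i. X' i s) i x"
        using velocity_distr[of "\<lambda>i. X' i s" "\<rho>' s" i x] measX' \<rho>' s by blast
      then show "((\<lambda>t. X' i t x) has_vector_derivative velocity (\<lambda>i. X' i s) i x) (at s within {0..T})"
        using derX'[OF s, of i x] by simp
    qed (use X0 X'0 measX measX' derX t in auto)
    then show ?thesis using \<rho>'[OF t(1)] by (simp add: \<rho>_def)
  qed
  ultimately show ?thesis by blast
qed

end
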